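(* Let $k$ and $n$ be positive integers, let $A_k$ be the $k$-element antichain, and let $Q\subseteq B_n$ be a poset. Then $Q$ is strongly $A_k$-free if and only if $w(Q)\le k-1$.
   Context: $B_n$ is the power set of $[n]=\{1,\dots,n\}$ ordered by inclusion; a subset $Q\subseteq B_n$ is regarded as a poset with the induced order. The width $w(Q)$ is the size of a largest antichain of $Q$ (with $w(\emptyset)=0$). $A_k$ is the poset with $k$ pairwise incomparable elements. An injection $f:P\to Q$ between posets is a strong embedding if $x\le y$ in $P$ if and only if $f(x)\le f(y)$ in $Q$; $Q$ is strongly $P$-free if there is no strong embedding of $P$ into $Q$. *)

theory Defs
  imports Main
begin

text \<open>
  A poset is represented by its reflexive order relation, a value of type \<^typ>\<open>'a rel\<close>;
  its ground set is the field of that relation.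
\<close>

definition boolean_cube :: "nat \<Rightarrow> nat set set" where
  "boolean_cube n = Pow {1..n}"

definition inclusion_order :: "'a set set \<Rightarrow> 'a set rel" where
  "inclusion_order Q = relation_of (\<subseteq>) Q"

definition antichain_poset :: "nat \<Rightarrow> nat rel" where
  "antichain_poset k = Id_on {1..k}"

definition antichain_in :: "'a rel \<Rightarrow> 'a set \<Rightarrow> bool" where
  "antichain_in r A \<longleftrightarrow> A \<subseteq> Field r \<and>
     (\<forall>x\<in>A. \<forall>y\<in>A. x \<noteq> y \<longrightarrow> (x, y) \<notin> r \<and> (y, x) \<notin> r)"

text \<open>
  The width is meaningful for finite posets only, as \<^const>\<open>Max\<close> is unspecified on infinite
  sets. The empty set is an antichain, so the empty poset has width 0.
\<close>

definition width :: "'a rel \<Rightarrow> nat" where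
  "width r = Max (card ` {A. antichain_in r A})"

definition strong_embedding :: "'a rel \<Rightarrow> 'b rel \<Rightarrow> ('a \<Rightarrow> 'b) \<Rightarrow> bool" where
  "strong_embedding p q f \<longleftrightarrow> inj_on f (Field p) \<and> f ` Field p \<subseteq> Field q \<and>
     (\<forall>x\<in>Field p. \<forall>y\<in>Field p. (x, y) \<in> p \<longleftrightarrow> (f x, f y) \<in> q)"

definition strongly_free :: "'a rel \<Rightarrow> 'b rel \<Rightarrow> bool" where
  "strongly_free p q \<longleftrightarrow> \<not> (\<exists>f. strong_embedding p q f)"

lemma Field_inclusion_order [simp]: "Field (inclusion_order Q) = Q"
  by (auto simp: inclusion_order_def relation_of_def Field_def)

lemma partial_order_on_inclusion_order: "partial_order_on Q (inclusion_order Q)"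
  by (auto simp: inclusion_order_def relation_of_def order_on_defs refl_on_def
      intro!: transI antisymI)

lemma Field_antichain_poset [simp]: "Field (antichain_poset k) = {1..k}"
  by (auto simp: antichain_poset_def Field_def)

lemma partial_order_on_antichain_poset: "partial_order_on {1..k} (antichain_poset k)"
  by (auto simp: antichain_poset_def order_on_defs refl_on_def intro!: transI antisymI)

lemma width_empty: "width (inclusion_order {}) = 0"
proof -
  have "{A. antichain_in (inclusion_order {} :: 'a set rel) A} = {{}}"
    by (auto simp: antichain_in_def)
  then show ?thesis
    by (simp add: width_def)
qed

end

theory Submission
  imports Defs
begin

text \<open>
  A strong embedding of the \<open>k\<close>-element antichain into a poset is the same thing as an
  enumeration of an antichain of size \<open>k\<close>: the image of such an embedding is an antichain, and
  every bijection from \<open>{1..k}\<close> onto an antichain is such an embedding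
  (\<open>strong_embedding_antichain_poset_iff\<close>). Subsets of antichains are antichains, so a finite
  poset has an antichain of size exactly \<open>k\<close> if and only if its width is at least \<open>k\<close>
  (\<open>le_width_iff\<close>). Hence being strongly free of the antichain means that the width is
  less than \<open>k\<close>.
\<close>

lemma antichain_in_subset:
  assumes "antichain_in r A" and "B \<subseteq> A"
  shows "antichain_in r B"
  using assms by (auto simp: antichain_in_def)

text \<open>
  Reflexivity on the field matters because the antichain poset relates each point to itself:
  an enumeration reflects the order in any case, but preserves it only if every point of the
  image is related to itself.
\<close>

lemma strong_embedding_antichain_poset_iff:
  assumes "refl_on (Field r) r"
  shows "(\<exists>f. strong_embedding (antichain_poset k) r f) \<longleftrightarrow>
    (\<exists>A. antichain_in r A \<and> finite A \<and> card A = k)"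
proof
  assume "\<exists>f. strong_embedding (antichain_poset k) r f"
  then obtain f where inj: "inj_on f {1..k}" and im: "f ` {1..k} \<subseteq> Field r"
    and ord: "\<forall>i\<in>{1..k}. \<forall>j\<in>{1..k}. (i, j) \<in> antichain_poset k \<longleftrightarrow> (f i, f j) \<in> r"
    by (auto simp: strong_embedding_def)
  have "antichain_in r (f ` {1..k})"
    using im ord by (auto simp: antichain_in_def antichain_poset_def)
  moreover have "card (f ` {1..k}) = k"
    using inj by (simp add: card_image)
  ultimately show "\<exists>A. antichain_in r A \<and> finite A \<and> card A = k"
    by blast
next
  assume "\<exists>A. antichain_in r A \<and> finite A \<and> card A = k"
  then obtain A where A: "antichain_in r A" "finite A" "card A = k"
    by blast
  then obtain f where f: "bij_betw f {1..k} A"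
    using ex_bij_betw_nat_finite_1 by blast
  have "(i, j) \<in> antichain_poset k \<longleftrightarrow> (f i, f j) \<in> r"
    if i: "i \<in> {1..k}" and j: "j \<in> {1..k}" for i j
  proof -
    have fi: "f i \<in> A" and fj: "f j \<in> A"
      using f i j by (auto dest: bij_betwE)
    have "(f i, f j) \<in> r \<longleftrightarrow> f i = f j"
      using A(1) fi fj assms by (auto simp: antichain_in_def refl_on_def)
    also have "\<dots> \<longleftrightarrow> i = j"
      using f i j by (auto simp: bij_betw_def inj_on_eq_iff)
    finally show ?thesis
      using i by (auto simp: antichain_poset_def)
  qed
  then have "strong_embedding (antichain_poset k) r f"
    using f A(1) by (simp add: strong_embedding_def bij_betw_def antichain_in_def)
  then show "\<exists>f. strong_embedding (antichain_poset k) r f"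
    by blast
qed

lemma le_width_iff:
  assumes "finite (Field r)"
  shows "k \<le> width r \<longleftrightarrow> (\<exists>A. antichain_in r A \<and> finite A \<and> card A = k)"
proof -
  let ?S = "{A. antichain_in r A}"
  have sub: "?S \<subseteq> Pow (Field r)"
    by (auto simp: antichain_in_def)
  then have fin: "finite (card ` ?S)"
    using assms by (blast intro: finite_subset)
  have ne: "card ` ?S \<noteq> {}"
    by (auto simp: antichain_in_def)
  have "k \<le> width r \<longleftrightarrow> (\<exists>A. antichain_in r A \<and> k \<le> card A)"
    using Max_ge_iff[OF fin ne] by (auto simp: width_def)
  also have "\<dots> \<longleftrightarrow> (\<exists>A. antichain_in r A \<and> finite A \<and> card A = k)"
  proof
    assume "\<exists>A. antichain_in r A \<and> k \<le> card A"
    then obtain A where A: "antichain_in r A" "k \<le> card A"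
      by blast
    \<comment> \<open>An antichain that is too large is trimmed to the size wanted.\<close>
    then obtain B where "B \<subseteq> A" "finite B" "card B = k"
      using obtain_subset_with_card_n by metis
    then show "\<exists>A. antichain_in r A \<and> finite A \<and> card A = k"
      using antichain_in_subset[OF A(1)] by blast
  qed auto
  finally show ?thesis .
qed

theorem lemma4p2:
  fixes k n :: nat and Q :: "nat set set"
  assumes "k \<ge> 1" and "n \<ge> 1"
    and "Q \<subseteq> boolean_cube n"
  shows "strongly_free (antichain_poset k) (inclusion_order Q) \<longleftrightarrow>
    width (inclusion_order Q) \<le> k - 1"
proof -
  let ?r = "inclusion_order Q"
  have refl: "refl_on (Field ?r) ?r"
    using partial_order_on_inclusion_order[of Q] by (simp add: order_on_defs)
  have fin: "finite (Field ?r)"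
    using assms(3) by (auto simp: boolean_cube_def intro: finite_subset)
  have "strongly_free (antichain_poset k) ?r \<longleftrightarrow> \<not> k \<le> width ?r"
    unfolding strongly_free_def strong_embedding_antichain_poset_iff[OF refl]
      le_width_iff[OF fin] ..
  also have "\<dots> \<longleftrightarrow> width ?r \<le> k - 1"
    using assms(1) by linarith
  finally show ?thesis .
qed

end
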